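(* Let $\mathbf{a}$ be an area sequence of length $n$. Then \begin{align*} \tilde{\mathrm{G}}_\mathbf{a}(\mathbf{x};q+1) = \sum_{\theta \in O(\Gamma_\mathbf{a})} q^{\mathrm{asc}(\theta)} \mathrm{e}_{\sigma(\theta)}(\mathbf{x}). \end{align*}
   Context: An area sequence is $\mathbf{a}=(a_1,\dotsc,a_n)$ with $0\le a_i\le i-1$ and $a_{i+1}\le a_i+1$; $\Gamma_\mathbf{a}$ has vertex set $[n]$ and directed edges $j\to i$ for $i-a_i\le j\le i-1$. For a standard Young tableau $T$ (English convention), the reading word reads rows from bottom to top, left to right within each row; $\mathrm{Des}(T)=\{i\in[n-1]: i+1 \text{ appears before } i \text{ in the reading word}\}$. Set $\mathrm{wt}_\mathbf{a}(T)=\sum_{i\in\mathrm{Des}(T)}a_{n+1-i}$ and $\tilde{\mathrm{G}}_\mathbf{a}(\mathbf{x};q)=\sum_{\lambda\vdash n}\sum_{T\in\mathrm{SYT}(\lambda)}q^{\mathrm{wt}_\mathbf{a}(T)}\mathrm{s}_\lambda(\mathbf{x})$. $O(\Gamma_\mathbf{a})$ is the set of orientations of undirected $\Gamma_\mathbf{a}$; an edge is ascending if oriented from smaller to larger vertex, $\mathrm{asc}(\theta)$ their number. A vertex $v$ is a bottom of $\theta$ if there is no $u<v$ with $(u,v)$ ascending (vertex $1$ is always a bottom). With bottoms $s_1>\dotsb>s_k$ and $s_0=n+1$, $\sigma(\theta)$ is the composition $(s_0-s_1,s_1-s_2,\dotsc,s_{k-1}-s_k)$ of $n$, and $\mathrm{e}_{\sigma(\theta)}=\prod_i\mathrm{e}_{\sigma(\theta)_i}$.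 *)

theory Defs
  imports "HOL-Library.Multiset" "HOL-Computational_Algebra.Polynomial"
begin

section \<open>Formal power series in countably many variables\<close>

text \<open>
  The variables are \<open>x\<^sub>0, x\<^sub>1, x\<^sub>2, \<dots>\<close>, and a monomial is the finite multiset of the indices
  of its variables, so that multiplication of monomials is union of multisets and the divisors
  of a monomial are its submultisets.
\<close>

typedef 'a mfps = "UNIV :: (nat multiset \<Rightarrow> 'a) set"
  morphisms mfps_coeff Abs_mfps
  by simp

lemma mfps_coeff_Abs [simp]: "mfps_coeff (Abs_mfps f) M = f M"
  by (simp add: Abs_mfps_inverse)

lemma mfps_ext: "(\<And>M. mfps_coeff f M = mfps_coeff g M) \<Longrightarrow> f = g"
  by (simp add: mfps_coeff_inject [symmetric] fun_eq_iff)

lemma finite_submultisets [simp]: "finite {A. A \<subseteq># (M :: 'a multiset)}"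
proof (induction M)
  case empty
  then show ?case by simp
next
  case (add x M)
  have "{A. A \<subseteq># add_mset x M} \<subseteq> {A. A \<subseteq># M} \<union> add_mset x ` {A. A \<subseteq># M}"
  proof
    fix A assume "A \<in> {A. A \<subseteq># add_mset x M}"
    then have *: "A \<subseteq># add_mset x M" by simp
    show "A \<in> {A. A \<subseteq># M} \<union> add_mset x ` {A. A \<subseteq># M}"
    proof (cases "x \<in># A")
      case True
      then obtain B where "A = add_mset x B" by (metis multi_member_split)
      with * show ?thesis by simp
    next
      case False
      with * have "A \<subseteq># M"
        by (metis add_mset_remove_trivial diff_single_trivial subset_eq_diff_conv 
              add_mset_add_single)
      then show ?thesis by simp
    qed
  qed
  with add show ?case by (meson finite_UnI finite_imageI finite_subset)
qed

instantiation mfps :: (zero) zero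
begin
definition "0 = Abs_mfps (\<lambda>M. 0)"
instance ..
end

instantiation mfps :: (zero_neq_one) one
begin
definition "1 = Abs_mfps (\<lambda>M. if M = {#} then 1 else 0)"
instance ..
end

instantiation mfps :: (plus) plus
begin
definition "f + g = Abs_mfps (\<lambda>M. mfps_coeff f M + mfps_coeff g M)"
instance ..
end

instantiation mfps :: (minus) minus
begin
definition "f - g = Abs_mfps (\<lambda>M. mfps_coeff f M - mfps_coeff g M)"
instance ..
end

instantiation mfps :: (uminus) uminus
begin
definition "- f = Abs_mfps (\<lambda>M. - mfps_coeff f M)"
instance ..
end

instantiation mfps :: (semiring_0) times
begin
definition "f * g = Abs_mfps (\<lambda>M. \<Sum>A | A \<subseteq># M. mfps_coeff f A * mfps_coeff g (M - A))"
instance ..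
end

lemma mfps_coeff_0 [simp]: "mfps_coeff 0 M = 0"
  by (simp add: zero_mfps_def)

lemma mfps_coeff_1: "mfps_coeff 1 M = (if M = {#} then 1 else 0)"
  by (simp add: one_mfps_def)

lemma mfps_coeff_add [simp]: "mfps_coeff (f + g) M = mfps_coeff f M + mfps_coeff g M"
  by (simp add: plus_mfps_def)

lemma mfps_coeff_diff [simp]: "mfps_coeff (f - g) M = mfps_coeff f M - mfps_coeff g M"
  by (simp add: minus_mfps_def)

lemma mfps_coeff_uminus [simp]: "mfps_coeff (- f) M = - mfps_coeff f M"
  by (simp add: uminus_mfps_def)

lemma mfps_coeff_mult:
  "mfps_coeff (f * g) M = (\<Sum>A | A \<subseteq># M. mfps_coeff f A * mfps_coeff g (M - A))"
  by (simp add: times_mfps_def)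

instance mfps :: (comm_ring_1) comm_ring_1
proof
  fix f g h :: "'a mfps"
  show "f * g = g * f"
  proof (rule mfps_ext)
    fix M
    show "mfps_coeff (f * g) M = mfps_coeff (g * f) M"
      unfolding mfps_coeff_mult
      by (rule sum.reindex_bij_witness [of _ "\<lambda>A. M - A" "\<lambda>A. M - A"])
        (auto simp: mult.commute subset_mset.diff_diff_right)
  qed
  show "f * g * h = f * (g * h)"
  proof (rule mfps_ext)
    fix M
    let ?f = "mfps_coeff f" and ?g = "mfps_coeff g" and ?h = "mfps_coeff h"
    have "mfps_coeff (f * g * h) M =
        (\<Sum>(A, B) \<in> (SIGMA A:{A. A \<subseteq># M}. {B. B \<subseteq># A}). ?f B * ?g (A - B) * ?h (M - A))"
      by (simp add: mfps_coeff_mult sum_distrib_right sum.Sigma)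
    also have "\<dots> = (\<Sum>(B, C) \<in> (SIGMA B:{B. B \<subseteq># M}. {C. C \<subseteq># M - B}).
        ?f B * (?g C * ?h (M - B - C)))"
    proof (rule sum.reindex_bij_witness [of _ "\<lambda>(B, C). (B + C, B)" "\<lambda>(A, B). (B, A - B)"],
        goal_cases)
      case (1 p)
      then show ?case
        by (auto simp: subset_mset.add_diff_inverse)
    next
      case (2 p)
      then show ?case
        by (auto simp: subseteq_mset_def intro: order_trans intro!: diff_le_mono)
    next
      case (3 p)
      then show ?case
        by auto
    next
      case (4 p)
      have "count B x + count C x \<le> count M x"
        if "\<forall>x. count B x \<le> count M x" "\<forall>x. count C x \<le> count M x - count B x" for B C x
        using that[THEN spec, of x] by linarith
      with 4 show ?case
        by (auto simp: subseteq_mset_def)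
    next
      case (5 p)
      have "M - B - (A - B) = M - A" if "B \<subseteq># A" for A B
        using that by (simp add: multiset_eq_iff subseteq_mset_def)
      with 5 show ?case
        by (auto simp: mult.assoc)
    qed
    also have "\<dots> = mfps_coeff (f * (g * h)) M"
      by (simp add: mfps_coeff_mult sum_distrib_left sum.Sigma)
    finally show "mfps_coeff (f * g * h) M = mfps_coeff (f * (g * h)) M" .
  qed
  show "1 * f = f"
  proof (rule mfps_ext)
    fix M
    have "mfps_coeff (1 * f) M = (\<Sum>A | A \<subseteq># M. if A = {#} then mfps_coeff f M else 0)"
      unfolding mfps_coeff_mult mfps_coeff_1 by (intro sum.cong) auto
    then show "mfps_coeff (1 * f) M = mfps_coeff f M"
      by simp
  qed
  show "(f + g) * h = f * h + g * h"
    by (rule mfps_ext) (simp add: mfps_coeff_mult distrib_right sum.distrib)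
  have "mfps_coeff (0 :: 'a mfps) {#} \<noteq> mfps_coeff 1 {#}"
    by (simp add: mfps_coeff_1)
  then show "(0 :: 'a mfps) \<noteq> 1"
    by metis
qed (rule mfps_ext; simp add: algebra_simps)+

definition mfps_const :: "'a::zero \<Rightarrow> 'a mfps"
  where "mfps_const c = Abs_mfps (\<lambda>M. if M = {#} then c else 0)"


section \<open>Partitions, tableaux and symmetric functions\<close>

definition partitions :: "nat \<Rightarrow> nat list set"
  where "partitions n = {p. sorted_wrt (\<ge>) p \<and> 0 \<notin> set p \<and> sum_list p = n}"

text \<open>
  A tableau in English convention is the list of its rows from top to bottom, each row being
  the list of its entries from left to right.
\<close>

definition columns_strict :: "nat list list \<Rightarrow> bool"
  where "columns_strict T \<longleftrightarrow>
    (\<forall>i j. Suc i < length T \<longrightarrow> j < length (T ! Suc i) \<longrightarrow> T ! i ! j < T ! Suc i ! j)"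

text \<open>The entries of a semistandard tableau are the indices of the variables, starting at 0.\<close>

definition SSYT :: "nat list \<Rightarrow> nat list list set"
  where "SSYT p = {T. map length T = p \<and> (\<forall>r \<in> set T. sorted_wrt (\<le>) r) \<and> columns_strict T}"

definition SYT :: "nat list \<Rightarrow> nat list list set"
  where "SYT p = {T. map length T = p \<and> (\<forall>r \<in> set T. sorted_wrt (<) r) \<and> columns_strict T \<and>
    mset (concat T) = mset_set {1..sum_list p}}"

definition schur :: "nat list \<Rightarrow> 'a::comm_ring_1 mfps"
  where "schur p = Abs_mfps (\<lambda>M. of_nat (card {T \<in> SSYT p. mset (concat T) = M}))"

text \<open>\<open>e\<^sub>k\<close> is the sum of all squarefree monomials of degree \<open>k\<close>.\<close>

definition elem_sym :: "nat \<Rightarrow> 'a::comm_ring_1 mfps"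
  where "elem_sym k = Abs_mfps (\<lambda>M. if size M = k \<and> (\<forall>i. count M i \<le> 1) then 1 else 0)"

definition elem_sym_comp :: "nat list \<Rightarrow> 'a::comm_ring_1 mfps"
  where "elem_sym_comp s = prod_list (map elem_sym s)"


section \<open>Area sequences and the function \<open>G\<close>\<close>

text \<open>
  A sequence \<open>(a\<^sub>1, \<dots>, a\<^sub>n)\<close> is given by its length \<open>n\<close> and a function \<open>a\<close>, of which only the
  values at \<open>1, \<dots>, n\<close> are used.
\<close>

definition area_sequence :: "nat \<Rightarrow> (nat \<Rightarrow> nat) \<Rightarrow> bool"
  where "area_sequence n a \<longleftrightarrow>
    (\<forall>i \<in> {1..n}. a i \<le> i - 1) \<and> (\<forall>i \<in> {1..<n}. a (i + 1) \<le> a i + 1)"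

definition reading_word :: "nat list list \<Rightarrow> nat list"
  where "reading_word T = concat (rev T)"

definition appears_before :: "'a \<Rightarrow> 'a \<Rightarrow> 'a list \<Rightarrow> bool"
  where "appears_before x y w \<longleftrightarrow> (\<exists>k l. k < l \<and> l < length w \<and> w ! k = x \<and> w ! l = y)"

definition Des :: "nat \<Rightarrow> nat list list \<Rightarrow> nat set"
  where "Des n T = {i \<in> {1..n - 1}. appears_before (i + 1) i (reading_word T)}"

definition wt :: "nat \<Rightarrow> (nat \<Rightarrow> nat) \<Rightarrow> nat list list \<Rightarrow> nat"
  where "wt n a T = (\<Sum>i \<in> Des n T. a (n + 1 - i))"

text \<open>
  The parameter \<open>q\<close> is an element of an arbitrary commutative coefficient ring; the case of an
  indeterminate is \<open>q = [:0, 1:]\<close> in the ring \<^typ>\<open>int poly\<close>.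
\<close>

definition G_tilde :: "nat \<Rightarrow> (nat \<Rightarrow> nat) \<Rightarrow> 'a::comm_ring_1 \<Rightarrow> 'a mfps"
  where "G_tilde n a q =
    (\<Sum>p \<in> partitions n. \<Sum>T \<in> SYT p. mfps_const (q ^ wt n a T) * schur p)"


section \<open>Orientations\<close>

definition Gamma_edges :: "nat \<Rightarrow> (nat \<Rightarrow> nat) \<Rightarrow> (nat \<times> nat) set"
  where "Gamma_edges n a = {(j, i). i \<in> {1..n} \<and> i - a i \<le> j \<and> j \<le> i - 1}"

text \<open>
  An orientation of the undirected graph underlying a loopless directed graph contains exactly
  one of \<open>(u, v)\<close> and \<open>(v, u)\<close> for every edge \<open>{u, v}\<close> and nothing else; a pair \<open>(u, v)\<close> is
  the edge oriented from \<open>u\<close> to \<open>v\<close>.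
\<close>

definition orientations :: "(nat \<times> nat) set \<Rightarrow> (nat \<times> nat) set set"
  where "orientations E = {\<theta>. \<theta> \<union> \<theta>\<inverse> = E \<union> E\<inverse> \<and> \<theta> \<inter> \<theta>\<inverse> = {}}"

definition asc :: "(nat \<times> nat) set \<Rightarrow> nat"
  where "asc \<theta> = card {(u, v) \<in> \<theta>. u < v}"

definition bottoms :: "nat \<Rightarrow> (nat \<times> nat) set \<Rightarrow> nat set"
  where "bottoms n \<theta> = {v \<in> {1..n}. \<not> (\<exists>u < v. (u, v) \<in> \<theta>)}"

text \<open>
  With \<open>s\<close> the decreasing list of bottoms \<open>[s\<^sub>1, \<dots>, s\<^sub>k]\<close>, this is the entrywise difference of
  \<open>[n + 1, s\<^sub>1, \<dots>, s\<^sub>k]\<close> and \<open>[s\<^sub>1, \<dots>, s\<^sub>k]\<close>, where the surplus last entry of the former is dropped.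
\<close>

definition sigma_comp :: "nat \<Rightarrow> (nat \<times> nat) set \<Rightarrow> nat list"
  where "sigma_comp n \<theta> =
    (let s = rev (sorted_list_of_set (bottoms n \<theta>)) in map2 (-) ((n + 1) # s) s)"

end

theory Submission
  imports Defs
begin

text \<open>
  The coefficient at a monomial \<open>M\<close> is on both sides a sum over the words \<open>w\<close> with content \<open>M\<close>.
  The Robinson--Schensted correspondence turns pairs of a semistandard tableau \<open>P\<close> and a standard
  tableau \<open>Q\<close> of the same shape into words, and descents of \<open>Q\<close> into rises of \<open>w\<close>, so that
  the left-hand side becomes the sum of \<open>(q + 1)\<close> to the power \<open>\<Sum>a v\<close> over the rises \<open>v\<close> of
  \<open>w\<close>. An orientation is determined by its set \<open>A\<close> of ascending edges, and the elementary
  symmetric function attached to it counts the words that rise at the upper end of every edge in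
  \<open>A\<close>. After exchanging the sums, \<open>A\<close> ranges over all subsets of the set \<open>F\<close> of edges whose
  upper end is a rise of \<open>w\<close>; these contribute \<open>(q + 1) ^ card F\<close>, and \<open>a v\<close> edges have
  upper end \<open>v\<close>.
\<close>

section \<open>Row insertion\<close>

text \<open>The second component is the bumped letter, or \<open>None\<close> if \<open>x\<close>
  was appended. Equal letters are passed over, which is the convention for weakly increasing
  rows.\<close>

fun row_insert :: "'a::linorder \<Rightarrow> 'a list \<Rightarrow> 'a list \<times> 'a option" where
  "row_insert x [] = ([x], None)"
| "row_insert x (y # ys) =
    (if x < y then (x # ys, Some y) else let (r, b) = row_insert x ys in (y # r, b))"

text \<open>Strict columns for two adjacent rows. The recursive form lets inductions run along both
  rows in step with \<open>row_insert\<close>.\<close>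

fun row_above :: "'a::linorder list \<Rightarrow> 'a list \<Rightarrow> bool" where
  "row_above r [] \<longleftrightarrow> True"
| "row_above [] (s # ss) \<longleftrightarrow> False"
| "row_above (r # rs) (s # ss) \<longleftrightarrow> r < s \<and> row_above rs ss"

lemma row_above_iff:
  "row_above r s \<longleftrightarrow> length s \<le> length r \<and> (\<forall>i < length s. r ! i < s ! i)"
  by (induction r s rule: row_above.induct) (auto simp: nth_Cons less_Suc_eq_0_disj split: nat.splits)

lemma row_insert_None:
  assumes "row_insert x r = (r', None)"
  shows "r' = r @ [x] \<and> (\<forall>y \<in> set r. y \<le> x)"
  using assms by (induction r arbitrary: r') (auto split: if_splits prod.splits)

lemma row_insert_append: "\<forall>y \<in> set r. y \<le> x \<Longrightarrow> row_insert x r = (r @ [x], None)"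
  by (induction r) auto

lemma row_insert_Some:
  assumes "row_insert x r = (r', Some b)"
  shows "x < b \<and> length r' = length r \<and> add_mset b (mset r') = add_mset x (mset r) \<and> r \<noteq> []"
  using assms by (induction r arbitrary: r') (auto split: if_splits prod.splits)

lemma in_row_insert: "x \<in> set (fst (row_insert x r))"
  by (induction r) (auto split: prod.splits)

lemma sorted_row_insert:
  assumes "sorted r"
  shows "sorted (fst (row_insert x r))"
proof -
  have *: "set (fst (row_insert x r)) \<subseteq> insert x (set r)" for r
    by (induction r) (auto split: prod.splits)
  show ?thesis
    using assms by (induction r) (use * in \<open>fastforce split: prod.splits\<close>)+
qed

text \<open>Bumping is reversible: in a sorted row everything after \<open>b\<close> is at least
  \<open>b\<close>, so \<open>x\<close> has to be the last entry of \<open>t\<close> below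
  \<open>b\<close>.\<close>

lemma row_insert_inj:
  assumes "row_insert x r = (t, Some b)" "row_insert y s = (t, Some b)" "sorted r" "sorted s"
  shows "x = y \<and> r = s"
  using assms
proof (induction r arbitrary: s t)
  case Nil
  then show ?case by auto
next
  case (Cons z r)
  note IH = Cons.IH and prems = Cons.prems
  obtain z' s' where s: "s = z' # s'"
    using prems row_insert_Some by (metis neq_Nil_conv)
  obtain t0 t' where t: "t = t0 # t'"
    using prems row_insert_Some by (metis length_0_conv neq_Nil_conv)
  show ?case
  proof (cases "x < z"; cases "y < z'")
    assume "x < z" "y < z'"
    then show ?thesis using prems s by auto
  next
    assume "\<not> x < z" "\<not> y < z'"
    then show ?thesis using prems s IH[of t' s'] t by (auto split: prod.splits)
  next
    \<comment> \<open>If only the first insertion bumps at the head, then \<open>y\<close> lies in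
      the tail \<open>r\<close> although it is smaller than the head \<open>z = b\<close>,
      contradicting sortedness. The next case is symmetric.\<close>
    assume h: "x < z" "\<not> y < z'"
    then have "t = x # r" "b = z" using prems by auto
    moreover obtain r'' where r'': "row_insert y s' = (r'', Some b)" "t = z' # r''"
      using prems s h by (auto split: prod.splits)
    moreover have "y \<in> set r''" "y < b"
      using in_row_insert[of y s'] r'' row_insert_Some by force+
    ultimately show ?thesis using prems by auto
  next
    assume h: "\<not> x < z" "y < z'"
    then have "t = y # s'" "b = z'" using prems s by auto
    moreover obtain r'' where r'': "row_insert x r = (r'', Some b)" "t = z # r''"
      using prems h by (auto split: prod.splits)
    moreover have "x \<in> set r''" "x < b"
      using in_row_insert[of x r] r'' row_insert_Some by force+
    ultimately show ?thesis using prems s by auto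
  qed
qed

text \<open>Reverse bumping puts \<open>b\<close> in place of the last entry of \<open>t\<close>
  below \<open>b\<close>; \<open>hd t < b\<close> ensures that there is one.\<close>

lemma row_insert_surj:
  assumes "sorted t" "t \<noteq> []" "hd t < b"
  shows "\<exists>x r. sorted r \<and> row_insert x r = (t, Some b)"
  using assms
proof (induction t)
  case Nil
  then show ?case by simp
next
  case (Cons y t)
  show ?case
  \<comment> \<open>These are the cases in which the head itself is the last entry below
    \<open>b\<close>.\<close>
  proof (cases "t = [] \<or> b \<le> hd t")
    case True
    then have "sorted (b # t)" using Cons.prems by (cases t) auto
    moreover have "row_insert y (b # t) = (y # t, Some b)" using Cons.prems by simp
    ultimately show ?thesis by blast
  next
    case False
    then obtain x r where xr: "sorted r" "row_insert x r = (t, Some b)"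
      using Cons by fastforce
    have m: "add_mset b (mset t) = add_mset x (mset r)" "x < b"
      using row_insert_Some[OF xr(2)] by auto
    have "x \<in> set t" using in_row_insert[of x r] xr by simp
    then have "y \<le> x" using Cons.prems by auto
    moreover have "\<forall>z \<in> set r. z = b \<or> z \<in> set t"
      using m by (metis insert_iff set_mset_add_mset_insert set_mset_mset)
    then have "sorted (y # r)" using Cons.prems xr(1) by auto
    ultimately show ?thesis using xr(2)
      by (intro exI[of _ x] exI[of _ "y # r"]) auto
  qed
qed

text \<open>Entries of the upper row only decrease, so the old \<open>s\<close> still fits below it.
  The entry of \<open>s\<close> under \<open>b\<close>, if any, exceeds \<open>b\<close>; hence
  \<open>b\<close> enters \<open>s\<close> weakly to the left of its old column, where
  \<open>r'\<close> has entries at most \<open>x < b\<close>.\<close>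

lemma row_above_row_insert:
  assumes "row_insert x r = (r', Some b)" "row_above r s" "sorted r"
  shows "row_above r' s \<and> row_above r' (fst (row_insert b s))"
  using assms
proof (induction r s arbitrary: r' rule: row_above.induct)
  case (1 r)
  show ?case
  proof (cases r)
    case (Cons y ys)
    then show ?thesis
      using 1 row_insert_Some[of x ys] by (fastforce split: if_splits prod.splits)
  qed (use 1 in simp)
next
  case (3 y ys s ss)
  show ?case
  proof (cases "x < y")
    case True
    then show ?thesis using 3 by auto
  next
    case False
    then obtain r'' where r'': "row_insert x ys = (r'', Some b)" "r' = y # r''"
      using "3.prems" by (auto split: prod.splits)
    then have "x < b" using row_insert_Some by blast
    then show ?thesis using 3 r'' False by (auto split: prod.splits)
  qed
qed simp

text \<open>The converse, needed to undo an insertion. The entries of \<open>r'\<close> right of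
  \<open>x\<close> are at least \<open>b\<close>, so \<open>b\<close> entered \<open>s\<close>
  weakly to the left of \<open>x\<close>; what stood in \<open>s\<close> under \<open>x\<close>
  therefore exceeds \<open>b\<close>.\<close>

lemma row_above_of_row_insert:
  assumes "row_insert x r = (r', Some b)" "row_above r' (fst (row_insert b s))" "sorted r" "sorted s"
  shows "row_above r s"
  using assms
proof (induction r s arbitrary: r' rule: row_above.induct)
  case (3 y ys s ss)
  \<comment> \<open>For the case that \<open>b\<close> displaced the head of the lower row: its tail
    \<open>ss\<close> is unchanged and exceeds \<open>b\<close>, so raising one entry of the upper
    row back to \<open>b\<close> does no harm.\<close>
  have aux: "row_above ys ss" if "row_insert x ys = (r'', Some b)" "row_above r'' ss" "\<forall>t \<in> set ss. b < t"
    for x b r'' and ys ss :: "'a list"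
    using that
    by (induction ys ss arbitrary: r'' rule: row_above.induct) (auto split: if_splits prod.splits)
  show ?case
  proof (cases "x < y")
    case True
    then have r': "r' = x # ys" "b = y" using "3.prems" by auto
    show ?thesis
    proof (cases "y < s")
      case True
      then show ?thesis using "3.prems" r' by auto
    next
      case False
      \<comment> \<open>This case is impossible: \<open>y\<close> goes into the tail
        \<open>ss\<close>, whose new head is at most \<open>y\<close>, while the entry of
        \<open>ys\<close> above that head is at least \<open>y\<close>.\<close>
      have *: "\<exists>t ts. fst (row_insert y ss) = t # ts \<and> t \<le> y"
        by (cases ss) (auto split: prod.splits)
      then obtain t ts where t: "fst (row_insert y ss) = t # ts" "t \<le> y" by blast
      have "row_above ys (t # ts)" using "3.prems" r' False t
        by (auto split: prod.splits)
      then obtain z zs where "ys = z # zs" "z < t" by (cases ys) auto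
      then show ?thesis using "3.prems" t by auto
    qed
  next
    case False
    then obtain r'' where r'': "row_insert x ys = (r'', Some b)" "r' = y # r''"
      using "3.prems" by (auto split: prod.splits)
    then have xb: "x < b" using row_insert_Some by blast
    show ?thesis
    proof (cases "b < s")
      case True
      then have "row_above r'' ss" using "3.prems" r'' by auto
      moreover have "\<forall>t \<in> set ss. b < t" using True "3.prems" by auto
      ultimately show ?thesis using aux[OF r''(1)] True xb False by auto
    next
      case False
      then show ?thesis using 3 r'' by (auto split: prod.splits)
    qed
  qed
qed (auto dest: row_insert_Some)

text \<open>A weakly larger second letter lands strictly to the right of the first, so it can bump
  only if the first one did.\<close>

lemma row_insert_row_insert_le:
  assumes "sorted r" "row_insert x r = (r', b)" "x \<le> y" "row_insert y r' = (r'', Some c)"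
  shows "\<exists>b'. b = Some b' \<and> b' \<le> c"
  using assms
proof (induction r arbitrary: r' r'')
  case (Cons z r)
  show ?case
  proof (cases "x < z")
    case True
    then have *: "r' = x # r" "b = Some z" using Cons.prems by auto
    then obtain t where t: "row_insert y r = (t, Some c)"
      using Cons.prems by (auto split: if_splits prod.splits)
    then have "c = y \<or> c \<in> set r" "y < c"
      using row_insert_Some[OF t] by (metis insert_iff set_mset_add_mset_insert set_mset_mset, metis)
    then show ?thesis using * Cons.prems by auto
  next
    case False
    then show ?thesis using Cons by (auto split: if_splits prod.splits)
  qed
qed (auto split: if_splits)

text \<open>After its insertion \<open>x\<close> is an entry of the row, so a smaller
  \<open>y\<close> bumps something at or left of it, and \<open>c \<le> x < b'\<close>.\<close>

lemma row_insert_row_insert_gr: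
  assumes "sorted r" "row_insert x r = (r', b)" "y < x"
  shows "\<exists>r'' c. row_insert y r' = (r'', Some c) \<and> (\<forall>b'. b = Some b' \<longrightarrow> c < b')"
  using assms
proof (induction r arbitrary: r')
  case (Cons z r)
  show ?case
  proof (cases "x < z")
    case True
    then show ?thesis using Cons.prems by auto
  next
    case False
    then obtain t where "row_insert x r = (t, b)" "r' = z # t"
      using Cons.prems by (auto split: prod.splits)
    then show ?thesis using Cons False row_insert_Some[of x r t] by fastforce
  qed
qed auto

section \<open>Tableaux\<close>

text \<open>The value at \<open>[]\<close> treats a missing row as an empty one, so the bottom of a
  tableau needs no separate case in \<open>tableau\<close>.\<close>

fun top_row :: "'a list list \<Rightarrow> 'a list" where
  "top_row [] = []"
| "top_row (r # T) = r"

text \<open>One notion for both tableaux of a pair: it is semistandard, and with distinct entries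
  the rows are strict. The shape is forced to be a partition by \<open>row_above\<close> and
  nonempty rows.\<close>

fun tableau :: "'a::linorder list list \<Rightarrow> bool" where
  "tableau [] \<longleftrightarrow> True"
| "tableau (r # T) \<longleftrightarrow> r \<noteq> [] \<and> sorted r \<and> row_above r (top_row T) \<and> tableau T"

text \<open>The second component is the index, from 0, of the row that gains a cell.\<close>

fun tab_insert :: "'a::linorder \<Rightarrow> 'a list list \<Rightarrow> 'a list list \<times> nat" where
  "tab_insert x [] = ([[x]], 0)"
| "tab_insert x (r # T) = (case row_insert x r of
      (r', None) \<Rightarrow> (r' # T, 0)
    | (r', Some b) \<Rightarrow> let (T', k) = tab_insert b T in (r' # T', Suc k))"

fun add_cell :: "nat \<Rightarrow> 'a \<Rightarrow> 'a list list \<Rightarrow> 'a list list" where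
  "add_cell 0 m [] = [[m]]"
| "add_cell 0 m (r # T) = (r @ [m]) # T"
| "add_cell (Suc k) m [] = [[m]]"
| "add_cell (Suc k) m (r # T) = r # add_cell k m T"

lemma tab_insert_row_le: "tab_insert x P = (P', k) \<Longrightarrow> k \<le> length P"
  by (induction x P arbitrary: P' k rule: tab_insert.induct)
    (auto split: prod.splits option.splits)

lemma mset_tab_insert:
  "tab_insert x P = (P', k) \<Longrightarrow> mset (concat P') = add_mset x (mset (concat P))"
proof (induction x P arbitrary: P' k rule: tab_insert.induct)
  case (2 x r T)
  show ?case
  proof (cases "row_insert x r")
    case (Pair r' b)
    show ?thesis
    proof (cases b)
      case None
      then show ?thesis using 2 Pair row_insert_None by fastforce
    next
      case (Some c)
      then have "add_mset c (mset r') = add_mset x (mset r)" using row_insert_Some Pair by blast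
      then show ?thesis using 2 Pair Some by (force split: prod.splits)
    qed
  qed
qed simp

lemma shape_add_cell:
  "map length Q = map length Q' \<Longrightarrow> map length (add_cell k m Q) = map length (add_cell k m' Q')"
  by (induction k m Q arbitrary: Q' rule: add_cell.induct) auto

lemma shape_tab_insert:
  assumes "tab_insert x P = (P', k)"
  shows "map length P' = map length (add_cell k m P)"
  using assms
  by (induction x P arbitrary: P' k rule: tab_insert.induct)
    (auto split: prod.splits option.splits dest: row_insert_None row_insert_Some)

lemma top_row_tab_insert: "top_row (fst (tab_insert x T)) = fst (row_insert x (top_row T))"
  by (cases T) (auto split: prod.splits option.splits)

lemma sorted_top_row: "tableau T \<Longrightarrow> sorted (top_row T)"
  by (cases T) auto

lemma row_above_snoc: "row_above r s \<Longrightarrow> row_above (r @ [x]) s"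
  by (auto simp: row_above_iff nth_append)

lemma tableau_tab_insert: "tableau P \<Longrightarrow> tableau (fst (tab_insert x P))"
proof (induction x P rule: tab_insert.induct)
  case (2 x r T)
  obtain r' b where r': "row_insert x r = (r', b)" by fastforce
  have s: "sorted r'" using sorted_row_insert[of r x] r' 2 by simp
  show ?case
  proof (cases b)
    case None
    then show ?thesis using r' row_insert_None[of x r r'] 2 s row_above_snoc[of r "top_row T" x] by auto
  next
    case (Some c)
    then have "row_above r' (fst (row_insert c (top_row T)))"
      using row_above_row_insert[of x r r' c "top_row T"] r' 2 by auto
    then have "row_above r' (top_row (fst (tab_insert c T)))" by (simp add: top_row_tab_insert)
    moreover have "r' \<noteq> []" using row_insert_Some r' Some by (metis length_0_conv)
    ultimately show ?thesis using r' Some 2 s by (auto split: prod.splits)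
  qed
qed simp

text \<open>The row \<open>k\<close> of the new cell tells where to start backwards: its last entry
  was appended, and \<open>row_insert_inj\<close> recovers the bumped letters row by row
  upwards.\<close>

lemma tab_insert_inj:
  assumes "tab_insert x P = (T, k)" "tab_insert y R = (T, k)" "tableau P" "tableau R"
  shows "x = y \<and> P = R"
  using assms
proof (induction x P arbitrary: y R T k rule: tab_insert.induct)
  case (1 x)
  show ?case
  proof (cases R)
    case (Cons s S)
    then show ?thesis using 1 row_insert_None[of y s "[x]"] row_insert_Some[of y s "[x]"]
      by (auto split: prod.splits option.splits)
  qed (use 1 in auto)
next
  case (2 x r P)
  show ?case
  proof (cases R)
    case Nil
    then show ?thesis using "2.prems" row_insert_None[of x r "[y]"]
      by (auto split: prod.splits option.splits)
  next
    case (Cons s S)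
    obtain r' b where r': "row_insert x r = (r', b)" by fastforce
    obtain s' c where s': "row_insert y s = (s', c)" by fastforce
    show ?thesis
    proof (cases b)
      case None
      then have "c = None" using "2.prems" Cons r' s' by (auto split: prod.splits option.splits)
      then show ?thesis using None "2.prems" Cons r' s' row_insert_None[of x r r'] row_insert_None[of y s s'] by auto
    next
      case (Some b')
      then obtain c' where c': "c = Some c'"
        using "2.prems" Cons r' s' by (auto split: prod.splits option.splits)
      obtain P' i where P': "tab_insert b' P = (P', i)" by fastforce
      have "tab_insert c' S = (P', i)" "s' = r'"
        using "2.prems" Cons r' s' c' Some P' by (auto split: prod.splits)
      moreover from this have "b' = c' \<and> P = S"
        using "2.IH"[OF r'[symmetric] Some P'] "2.prems" Cons by auto
      ultimately show ?thesis using row_insert_inj[of x r r' b' y s] r' s' Some c' "2.prems" Cons by auto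
    qed
  qed
qed

text \<open>\<open>Q\<close> stands for the shape left after removing the new cell. The last entry
  of row \<open>k\<close> is taken out and bumped backwards through the rows above.\<close>

lemma tab_insert_surj:
  assumes "tableau P'" "map length P' = map length (add_cell k m Q)" "tableau Q" "k \<le> length Q"
  shows "\<exists>x P. tableau P \<and> map length P = map length Q \<and> tab_insert x P = (P', k)"
  using assms
proof (induction k m Q arbitrary: P' rule: add_cell.induct)
  case (1 m)
  then obtain x where "P' = [[x]]" by (auto simp: length_Suc_conv)
  then show ?case by (intro exI[of _ x] exI[of _ "[]"]) auto
next
  case (2 m r T)
  then obtain r' T' where P': "P' = r' # T'" "length r' = Suc (length r)" "map length T' = map length T"
    by auto
  then obtain s x where r': "r' = s @ [x]" "length s = length r" by (auto simp: length_Suc_conv_rev)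
  \<comment> \<open>The shortened row \<open>s\<close> still covers the row below it, because its
    length is that of \<open>r\<close> and \<open>Q\<close> is a tableau.\<close>
  have "length (top_row T') = length (top_row T)" using P'(3) by (cases T; cases T') auto
  then have "row_above s (top_row T')" using 2 P' r'
    by (auto simp: row_above_iff nth_append)
  then have "tableau (s # T')" using 2 P' r' by (auto simp: sorted_append)
  moreover have "tab_insert x (s # T') = (P', 0)"
    using row_insert_append[of s x] 2 P' r' by (auto simp: sorted_append)
  ultimately show ?case using P' r' by (intro exI[of _ x] exI[of _ "s # T'"]) auto
next
  case (4 k m r T)
  then obtain r' T' where P': "P' = r' # T'" "length r' = length r"
    "map length T' = map length (add_cell k m T)" by auto
  then obtain b S where S: "tableau S" "map length S = map length T" "tab_insert b S = (T', k)"
    using 4 by fastforce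
  have T': "top_row T' = fst (row_insert b (top_row S))" using top_row_tab_insert[of b S] S by simp
  then have "b \<in> set (top_row T')" by (simp add: in_row_insert)
  \<comment> \<open>Reverse bumping into \<open>r'\<close> requires an entry below \<open>b\<close>;
    it is found above the place of \<open>b\<close> in the next row.\<close>
  then obtain j where j: "j < length (top_row T')" "top_row T' ! j = b" by (auto simp: in_set_conv_nth)
  have ab: "row_above r' (top_row T')" "sorted r'" "r' \<noteq> []" using 4 P' by auto
  then have "r' ! j < b" "j < length r'" using j by (auto simp: row_above_iff)
  moreover have "hd r' \<le> r' ! j"
    using ab \<open>j < length r'\<close> by (simp add: hd_conv_nth sorted_nth_mono)
  ultimately obtain x s where s: "sorted s" "row_insert x s = (r', Some b)"
    using row_insert_surj[of r' b] ab by fastforce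
  have "row_above s (top_row S)"
    using row_above_of_row_insert[OF s(2) _ s(1) sorted_top_row[OF S(1)]] ab T' by simp
  moreover have "length s = length r'" "s \<noteq> []" using row_insert_Some[OF s(2)] by auto
  ultimately show ?case using s S P'
    by (intro exI[of _ x] exI[of _ "s # S"]) auto
qed auto

text \<open>The source of descents. The comparison of \<open>x\<close> and \<open>y\<close> is
  inherited by the letters they bump, and is decided in the first row where one of them is
  appended.\<close>

lemma tab_insert_tab_insert_row:
  assumes "tableau P" "tab_insert x P = (P', k)" "tab_insert y P' = (P'', l)"
  shows "k < l \<longleftrightarrow> y < x"
  using assms
proof (induction x P arbitrary: y P' k P'' l rule: tab_insert.induct)
  case (1 x)
  then show ?case by (auto split: if_splits prod.splits)
next
  case (2 x r P)
  obtain r' b where r': "row_insert x r = (r', b)" by fastforce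
  obtain T k' where T: "P' = r' # T"
    using "2.prems" r' by (auto split: prod.splits option.splits)
  obtain r'' c where r'': "row_insert y r' = (r'', c)" by fastforce
  show ?case
  proof (cases "y < x")
    case True
    then obtain c' where c': "c = Some c'" "\<And>b'. b = Some b' \<Longrightarrow> c' < b'"
      using row_insert_row_insert_gr[OF _ r' True] r'' 2 by auto
    show ?thesis
    proof (cases b)
      case None
      then show ?thesis using 2 r' r'' c' True by (auto split: prod.splits)
    next
      case (Some b')
      obtain S i where S: "tab_insert b' P = (S, i)" by fastforce
      obtain S' j where S': "tab_insert c' S = (S', j)" by fastforce
      have "i < j" using "2.IH"[OF r'[symmetric] Some _ S S'] 2 c' Some by simp
      then show ?thesis using 2 S S' r' r'' c' Some True by (auto split: prod.splits)
    qed
  next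
    case False
    show ?thesis
    proof (cases c)
      case None
      then show ?thesis using 2 r' r'' False T by (auto split: prod.splits)
    next
      case (Some c')
      then obtain b' where b': "b = Some b'" "b' \<le> c'"
        using row_insert_row_insert_le[of r x r' b y r'' c'] r' r'' Some False "2.prems" by (auto simp: not_less)
      obtain S i where S: "tab_insert b' P = (S, i)" by fastforce
      obtain S' j where S': "tab_insert c' S = (S', j)" by fastforce
      have "\<not> i < j" using "2.IH"[OF r'[symmetric] b'(1) _ S S'] 2 b' by simp
      then show ?thesis using 2 S S' r' r'' b' Some False by (auto split: prod.splits)
    qed
  qed
qed


section \<open>Adding and removing the cell of a largest entry\<close>

lemma mset_add_cell: "mset (concat (add_cell k m Q)) = add_mset m (mset (concat Q))"
  by (induction k m Q rule: add_cell.induct) auto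

lemma top_row_add_cell:
  "k \<le> length T \<Longrightarrow> top_row (add_cell k m T) = (if k = 0 then top_row T @ [m] else top_row T)"
  by (cases "(k, m, T)" rule: add_cell.cases) auto

text \<open>The tableau \<open>P\<close> certifies that the enlarged shape is a partition; the order
  conditions at the new cell hold because \<open>m\<close> exceeds all other entries.\<close>

lemma tableau_add_cell:
  assumes "tableau Q" "\<forall>y \<in> set (concat Q). y < m" "k \<le> length Q"
    "tableau P" "map length P = map length (add_cell k m Q)"
  shows "tableau (add_cell k m Q)"
  using assms
proof (induction k m Q arbitrary: P rule: add_cell.induct)
  case (2 m r T)
  then show ?case by (auto simp: sorted_append row_above_snoc less_imp_le)
next
  case (4 k m r T)
  then obtain r' T' where P: "P = r' # T'" "length r' = length r"
    "map length T' = map length (add_cell k m T)" by auto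
  have "row_above r (top_row (add_cell k m T))"
  \<comment> \<open>For \<open>k = 0\<close> the row directly below \<open>r\<close> grows, and
    \<open>P\<close> shows that it does not become longer than \<open>r\<close>.\<close>
  proof (cases "k = 0")
    case True
    have "length (top_row T') = length (top_row (add_cell k m T))"
      using P(3) by (cases T'; cases "add_cell k m T") auto
    then have "length (top_row T @ [m]) \<le> length r"
      using 4 P True by (simp add: top_row_add_cell row_above_iff)
    moreover have "row_above r (top_row T)" "\<forall>y \<in> set r. y < m" using 4 by auto
    ultimately show ?thesis using True 4
      by (auto simp: top_row_add_cell row_above_iff nth_append)
  next
    case False
    then show ?thesis using 4 by (simp add: top_row_add_cell)
  qed
  then show ?case using 4 P by auto
qed auto

text \<open>In the topmost row containing it, the maximum occupies the last cell, and strict columns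
  leave nothing below that cell.\<close>

lemma tableau_remove_max:
  assumes "tableau T" "m \<in> set (concat T)" "\<forall>y \<in> set (concat T). y \<le> m"
  shows "\<exists>k Q. tableau Q \<and> k \<le> length Q \<and> T = add_cell k m Q"
  using assms
proof (induction T)
  case (Cons r T)
  show ?case
  proof (cases "m \<in> set r")
    case True
    then have "r \<noteq> []" by auto
    then obtain s x where r: "r = s @ [x]" by (meson rev_exhaust)
    then have x: "x = m" using Cons.prems True by (auto simp: sorted_append intro: antisym)
    have top: "\<forall>y \<in> set (top_row T). y \<le> m" using Cons.prems by (cases T) auto
    have above: "row_above s (top_row T)"
    proof -
      have "\<not> length s < length (top_row T)"
      proof
        assume l: "length s < length (top_row T)"
        then have "r ! length s < top_row T ! length s"
          using Cons.prems(1) by (simp add: row_above_iff)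
        moreover have "top_row T ! length s \<le> m" using top l by simp
        ultimately show False using r x by simp
      qed
      then show ?thesis using Cons.prems(1) r by (auto simp: row_above_iff nth_append)
    qed
    show ?thesis
    proof (cases "s = []")
      case True
      \<comment> \<open>When \<open>m\<close> is alone in its row, the row disappears, and
        \<open>add_cell 0 m []\<close> restores it.\<close>
      then have "T = []" using above Cons.prems(1) by (cases T; cases "top_row T") auto
      then show ?thesis using True r x by (intro exI[of _ 0] exI[of _ "[]"]) auto
    next
      case False
      then show ?thesis using r x above Cons.prems
        by (intro exI[of _ 0] exI[of _ "s # T"]) (auto simp: sorted_append)
    qed
  next
    case False
    then obtain k Q where Q: "tableau Q" "k \<le> length Q" "T = add_cell k m Q"
      using Cons by auto
    then have "row_above r (top_row Q)"
      using Cons.prems(1) by (auto simp: top_row_add_cell row_above_iff nth_append split: if_splits)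
    then show ?thesis using Q Cons.prems by (intro exI[of _ "Suc k"] exI[of _ "r # Q"]) auto
  qed
qed simp

text \<open>\<open>m\<close> occurs once, so its row is determined. Rows of a tableau are nonempty,
  so opening a new row cannot be confused with extending an empty one.\<close>

lemma add_cell_inj:
  assumes "add_cell k m Q = add_cell l m R" "m \<notin> set (concat Q)" "m \<notin> set (concat R)"
    "tableau Q" "tableau R" "k \<le> length Q" "l \<le> length R"
  shows "k = l \<and> Q = R"
  using assms
proof (induction k m Q arbitrary: l R rule: add_cell.induct)
  case (1 m)
  then show ?case by (cases "(l, m, R)" rule: add_cell.cases) auto
next
  case (2 m r T)
  then show ?case by (cases "(l, m, R)" rule: add_cell.cases) auto
next
  case (3 k m)
  then show ?case by simp
next
  case (4 k m r T)
  show ?case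
  proof (cases "(l, m, R)" rule: add_cell.cases)
    case (4 k' m' r' T')
    then show ?thesis using "4.prems" "4.IH"[of k' T'] by auto
  qed (use "4.prems" in auto)
qed

lemma in_take_add_cell:
  assumes "m \<notin> set (concat Q)" "k \<le> length Q"
  shows "m \<in> set (concat (take l (add_cell k m Q))) \<longleftrightarrow> k < l"
  using assms
proof (induction k m Q arbitrary: l rule: add_cell.induct)
  case (1 m)
  then show ?case by (cases l) auto
next
  case (2 m r T)
  then show ?case by (cases l) auto
next
  case (3 k m)
  then show ?case by simp
next
  case (4 k m r T)
  then show ?case by (cases l) auto
qed

section \<open>Reading words and order of appearance\<close>

text \<open>Row \<open>k\<close> is the last row of \<open>drop k Q\<close> to be read, so a letter
  at its end falls exactly between the two halves.\<close>

lemma reading_word_add_cell: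
  assumes "k \<le> length Q"
  shows "reading_word (add_cell k m Q) = concat (rev (drop k Q)) @ m # concat (rev (take k Q))"
  using assms unfolding reading_word_def by (induction k m Q rule: add_cell.induct) auto

lemma reading_word_split: "reading_word Q = concat (rev (drop k Q)) @ concat (rev (take k Q))"
  unfolding reading_word_def by (metis append_take_drop_id concat_append rev_append)

lemma set_reading_word: "set (reading_word Q) = set (concat Q)"
  by (simp add: reading_word_def)

lemma appears_before_Nil: "\<not> appears_before x y []"
  by (simp add: appears_before_def)

lemma appears_before_Cons:
  "appears_before x y (z # w) \<longleftrightarrow> (x = z \<and> y \<in> set w) \<or> appears_before x y w"
proof
  assume "appears_before x y (z # w)"
  then obtain k l where kl: "k < l" "l < length (z # w)" "(z # w) ! k = x" "(z # w) ! l = y"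
    unfolding appears_before_def by blast
  then obtain l' where "l = Suc l'" by (cases l) auto
  with kl show "(x = z \<and> y \<in> set w) \<or> appears_before x y w"
    unfolding appears_before_def by (cases k) auto
next
  assume "(x = z \<and> y \<in> set w) \<or> appears_before x y w"
  then show "appears_before x y (z # w)"
  proof
    assume "x = z \<and> y \<in> set w"
    then obtain l where "x = z" "l < length w" "w ! l = y" by (auto simp: in_set_conv_nth)
    then show ?thesis
      unfolding appears_before_def by (intro exI[of _ 0] exI[of _ "Suc l"]) auto
  next
    assume "appears_before x y w"
    then obtain k l where "k < l" "l < length w" "w ! k = x" "w ! l = y"
      unfolding appears_before_def by blast
    then show ?thesis
      unfolding appears_before_def by (intro exI[of _ "Suc k"] exI[of _ "Suc l"]) auto
  qed
qed

lemma appears_before_append: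
  "appears_before x y (u @ v) \<longleftrightarrow>
    appears_before x y u \<or> appears_before x y v \<or> (x \<in> set u \<and> y \<in> set v)"
  by (induction u) (auto simp: appears_before_Cons appears_before_Nil)

lemma appears_before_in_set: "appears_before x y w \<Longrightarrow> x \<in> set w \<and> y \<in> set w"
  by (induction w) (auto simp: appears_before_Cons appears_before_Nil)

section \<open>The Robinson--Schensted correspondence\<close>

text \<open>Letters are inserted from right to left, because the weight of a tableau reads the
  area sequence backwards.\<close>

fun rsk :: "'a::linorder list \<Rightarrow> 'a list list \<times> nat list list" where
  "rsk [] = ([], [])"
| "rsk (x # w) = (let (P, Q) = rsk w; (P', k) = tab_insert x P
      in (P', add_cell k (Suc (length w)) Q))"

lemma mset_set_Suc: "mset_set {1..Suc n} = add_mset (Suc n) (mset_set {1..n})"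
  by (simp add: atLeastAtMostSuc_conv)

lemma mset_eq_interval_set: "mset xs = mset_set {1..n::nat} \<Longrightarrow> set xs = {1..n}"
  by (drule arg_cong[of _ _ set_mset]) simp

lemma rsk_correct:
  assumes "rsk w = (P, Q)"
  shows "tableau P \<and> tableau Q \<and> map length P = map length Q \<and> mset (concat P) = mset w \<and>
    mset (concat Q) = mset_set {1..length w}"
  using assms
proof (induction w arbitrary: P Q)
  case (Cons x w)
  obtain P0 Q0 where 0: "rsk w = (P0, Q0)" by fastforce
  obtain P1 k where 1: "tab_insert x P0 = (P1, k)" by fastforce
  have eq: "P = P1" "Q = add_cell k (Suc (length w)) Q0" using Cons.prems 0 1 by auto
  have IH: "tableau P0" "tableau Q0" "map length P0 = map length Q0" "mset (concat P0) = mset w"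
    "mset (concat Q0) = mset_set {1..length w}" using Cons.IH[OF 0] by auto
  have k: "k \<le> length Q0" using tab_insert_row_le[OF 1] IH(3) by (metis length_map)
  have sh: "map length P1 = map length (add_cell k (Suc (length w)) Q0)"
    using trans[OF shape_tab_insert[OF 1] shape_add_cell[OF IH(3)]] .
  have P1: "tableau P1" using tableau_tab_insert[OF IH(1), of x] 1 by simp
  have "tableau Q"
    unfolding eq using mset_eq_interval_set[OF IH(5)]
    by (intro tableau_add_cell[OF IH(2) _ k P1 sh]) simp
  moreover have "mset (concat P) = mset (x # w)"
    unfolding eq using mset_tab_insert[OF 1] IH(4) by simp
  moreover have "mset (concat Q) = mset_set {1..length (x # w)}"
    unfolding eq mset_add_cell IH(5) list.size add_0_right add_Suc_right mset_set_Suc ..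
  ultimately show ?case using sh P1 unfolding eq by blast
qed simp

text \<open>Equal lengths make the largest recorded entry the same; its cell names the row from
  which to undo the last insertion.\<close>

lemma rsk_inj: "rsk v = rsk w \<Longrightarrow> length v = length w \<Longrightarrow> v = w"
proof (induction v w rule: list_induct2')
  case (4 x v y w)
  obtain P Q where 0: "rsk v = (P, Q)" by fastforce
  obtain P' k where 1: "tab_insert x P = (P', k)" by fastforce
  obtain R S where 2: "rsk w = (R, S)" by fastforce
  obtain R' l where 3: "tab_insert y R = (R', l)" by fastforce
  let ?m = "Suc (length v)"
  have eq: "P' = R'" "add_cell k ?m Q = add_cell l ?m S" using 4 0 1 2 3 by auto
  have p: "tableau P" "tableau Q" "map length P = map length Q" "mset (concat Q) = mset_set {1..length v}"
    "tableau R" "tableau S" "map length R = map length S" "mset (concat S) = mset_set {1..length v}"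
    using rsk_correct[OF 0] rsk_correct[OF 2] 4 by auto
  have kl: "k \<le> length Q" "l \<le> length S"
    using tab_insert_row_le[OF 1] tab_insert_row_le[OF 3] p(3,7) by (metis length_map)+
  have "k = l \<and> Q = S"
    by (rule add_cell_inj[OF eq(2) _ _ p(2,6) kl])
      (use mset_eq_interval_set[OF p(4)] mset_eq_interval_set[OF p(8)] in simp_all)
  then show ?case using tab_insert_inj[of x P P' k y R] 0 1 2 3 eq p 4 by auto
qed auto

text \<open>The cell of the largest entry of \<open>Q\<close> prescribes the row for one reverse
  insertion into \<open>P\<close>.\<close>

lemma rsk_surj:
  assumes "tableau P" "tableau Q" "map length P = map length Q" "mset (concat Q) = mset_set {1..n}"
  shows "\<exists>w. length w = n \<and> rsk w = (P, Q)"
  using assms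
proof (induction n arbitrary: P Q)
  case 0
  then have "Q = []" by (cases Q) auto
  then show ?case using 0 by auto
next
  case (Suc n)
  have "\<exists>k Q0. tableau Q0 \<and> k \<le> length Q0 \<and> Q = add_cell k (Suc n) Q0"
    by (rule tableau_remove_max[OF Suc.prems(2)]) (use mset_eq_interval_set[OF Suc.prems(4)] in auto)
  then obtain k Q0 where Q0: "tableau Q0" "k \<le> length Q0" "Q = add_cell k (Suc n) Q0" by blast
  obtain x P0 where P0: "tableau P0" "map length P0 = map length Q0" "tab_insert x P0 = (P, k)"
    using tab_insert_surj[OF Suc.prems(1) _ Q0(1,2)] Suc.prems(3) Q0(3) by metis
  have "mset (concat Q0) = mset_set {1..n}"
    using Suc.prems(4) unfolding Q0(3) mset_add_cell mset_set_Suc by simp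
  then obtain w where "length w = n" "rsk w = (P0, Q0)" using Suc.IH[OF P0(1) Q0(1) P0(2)] by blast
  then show ?case using P0 Q0 by (intro exI[of _ "x # w"]) auto
qed

lemma bij_betw_rsk:
  "bij_betw rsk {w. mset w = M \<and> length w = n}
    {(P, Q). tableau P \<and> tableau Q \<and> map length P = map length Q \<and>
      mset (concat P) = M \<and> mset (concat Q) = mset_set {1..n}}"
proof (rule bij_betw_imageI)
  show "inj_on rsk {w. mset w = M \<and> length w = n}"
    by (auto intro!: inj_onI rsk_inj)
  show "rsk ` {w. mset w = M \<and> length w = n} = {(P, Q). tableau P \<and> tableau Q \<and>
      map length P = map length Q \<and> mset (concat P) = M \<and> mset (concat Q) = mset_set {1..n}}"
    (is "_ ` ?W = ?T")
  proof (intro subset_antisym subsetI)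
    fix z assume "z \<in> rsk ` ?W"
    then obtain w where "w \<in> ?W" "z = rsk w" by blast
    moreover obtain P Q where "rsk w = (P, Q)" by fastforce
    ultimately show "z \<in> ?T" using rsk_correct[of w P Q] by auto
  next
    fix z assume "z \<in> ?T"
    then obtain P Q where z: "z = (P, Q)" "tableau P" "tableau Q" "map length P = map length Q"
      "mset (concat P) = M" "mset (concat Q) = mset_set {1..n}" by blast
    then obtain w where w: "length w = n" "rsk w = (P, Q)" using rsk_surj by blast
    then have "mset w = M" using rsk_correct[OF w(2)] z by simp
    then show "z \<in> rsk ` ?W" using w z by (intro image_eqI[of _ _ w]) simp_all
  qed
qed

text \<open>Entry \<open>i\<close> records the insertion of the letter at index
  \<open>length w - i\<close>, and \<open>Suc i\<close> that of its left neighbour. The later entry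
  is read first iff its cell is in a strictly lower row, that is, iff its letter is smaller.\<close>

lemma appears_before_rsk:
  assumes "rsk w = (P, Q)" "1 \<le> i" "i < length w"
  shows "appears_before (Suc i) i (reading_word Q) \<longleftrightarrow>
    w ! (length w - Suc i) < w ! (length w - i)"
  using assms
proof (induction w arbitrary: P Q)
  case (Cons x w)
  let ?m = "Suc (length w)"
  obtain P0 Q0 where 0: "rsk w = (P0, Q0)" by fastforce
  obtain P1 k where 1: "tab_insert x P0 = (P1, k)" by fastforce
  have Q: "Q = add_cell k ?m Q0" using Cons.prems 0 1 by auto
  have p: "tableau P0" "map length P0 = map length Q0" "mset (concat Q0) = mset_set {1..length w}"
    using rsk_correct[OF 0] by auto
  have k: "k \<le> length Q0" using tab_insert_row_le[OF 1] p(2) by (metis length_map)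
  define u where "u = concat (rev (drop k Q0))"
  define v where "v = concat (rev (take k Q0))"
  have rw: "reading_word Q = u @ ?m # v" "reading_word Q0 = u @ v"
    using reading_word_add_cell[OF k] reading_word_split[of Q0 k] by (auto simp: u_def v_def Q)
  have uv: "?m \<notin> set u" "?m \<notin> set v"
  proof -
    have "set u \<union> set v = {1..length w}"
      using mset_eq_interval_set[OF p(3)] set_reading_word[of Q0] rw(2) by (metis set_append)
    then have "?m \<notin> set u \<union> set v" by (simp del: Un_iff)
    then show "?m \<notin> set u" "?m \<notin> set v" by auto
  qed
  show ?case
  proof (cases "i < length w")
    case True
    \<comment> \<open>The new entry \<open>?m\<close> differs from both \<open>i\<close> and
      \<open>Suc i\<close>, so it does not affect their order.\<close>
    have "appears_before (Suc i) i (reading_word Q) \<longleftrightarrow> appears_before (Suc i) i (reading_word Q0)"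
      using True unfolding rw appears_before_append appears_before_Cons by auto
    also have "\<dots> \<longleftrightarrow> w ! (length w - Suc i) < w ! (length w - i)"
      using Cons.IH[OF 0] Cons.prems True by simp
    also have "w ! (length w - Suc i) = (x # w) ! (length (x # w) - Suc i)"
      using True by (simp add: Suc_diff_Suc[symmetric] nth_Cons')
    also have "w ! (length w - i) = (x # w) ! (length (x # w) - i)"
      using True by (simp add: Suc_diff_le nth_Cons')
    finally show ?thesis .
  next
    case False
    \<comment> \<open>Now \<open>Suc i\<close> is the new entry \<open>?m\<close> between
      \<open>u\<close> and \<open>v\<close>; it precedes \<open>i\<close> iff \<open>i\<close> lies
      in \<open>v\<close>, the rows above row \<open>k\<close>. This compares the rows of the last
      two insertions.\<close>
    then have i: "i = length w" using Cons.prems by simp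
    then obtain y w' where w: "w = y # w'" using Cons.prems by (cases w) auto
    obtain R S where RS: "rsk w' = (R, S)" by fastforce
    obtain R' l where l: "tab_insert y R = (R', l)" by fastforce
    have eq: "P0 = R'" "Q0 = add_cell l i S" using 0 RS l w i by auto
    have s: "tableau R" "map length R = map length S" "mset (concat S) = mset_set {1..length w'}"
      using rsk_correct[OF RS] by auto
    have "l \<le> length S" using tab_insert_row_le[OF l] s(2) by (metis length_map)
    moreover have "i \<notin> set (concat S)" using mset_eq_interval_set[OF s(3)] i w by simp
    ultimately have "i \<in> set v \<longleftrightarrow> l < k"
      using in_take_add_cell[of i S l k] unfolding v_def eq(2) by simp
    also have "\<dots> \<longleftrightarrow> x < y" using tab_insert_tab_insert_row[OF s(1) l] 1 eq by simp
    finally have "i \<in> set v \<longleftrightarrow> x < y" .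
    moreover have "appears_before (Suc i) i (reading_word Q) \<longleftrightarrow> i \<in> set v"
      using uv appears_before_in_set[of ?m i] i
      unfolding rw appears_before_append appears_before_Cons by auto
    ultimately show ?thesis using i w by simp
  qed
qed simp

section \<open>Comparison of coefficients\<close>

lemma mfps_coeff_sum: "mfps_coeff (sum f A) M = (\<Sum>x\<in>A. mfps_coeff (f x) M)"
  by (induction A rule: infinite_finite_induct) auto

lemma mfps_coeff_const_mult: "mfps_coeff (mfps_const c * f) M = c * mfps_coeff f M"
proof -
  have "mfps_coeff (mfps_const c * f) M =
      (\<Sum>A | A \<subseteq># M. if A = {#} then c * mfps_coeff f M else 0)"
    unfolding mfps_coeff_mult by (intro sum.cong) (auto simp: mfps_const_def)
  then show ?thesis by simp
qed

section \<open>Semistandard and standard tableaux in terms of \<open>tableau\<close>, and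
  finiteness\<close>

lemma columns_strict_Cons:
  "columns_strict (r # T) \<longleftrightarrow> (\<forall>j < length (top_row T). r ! j < top_row T ! j) \<and> columns_strict T"
proof (cases T)
  case (Cons s S)
  have all_Suc: "(\<forall>i. P i) \<longleftrightarrow> P 0 \<and> (\<forall>i. P (Suc i))" for P :: "nat \<Rightarrow> bool"
    by (metis not0_implies_Suc)
  have "columns_strict (r # T) \<longleftrightarrow> (\<forall>i. Suc i < length (r # T) \<longrightarrow>
      (\<forall>j < length ((r # T) ! Suc i). (r # T) ! i ! j < (r # T) ! Suc i ! j))"
    unfolding columns_strict_def by blast
  also have "\<dots> \<longleftrightarrow> (\<forall>j < length s. r ! j < s ! j) \<and>
      (\<forall>i. Suc i < length T \<longrightarrow> (\<forall>j < length (T ! Suc i). T ! i ! j < T ! Suc i ! j))"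
    unfolding Cons by (subst all_Suc) auto
  finally show ?thesis unfolding columns_strict_def Cons by auto
qed (simp add: columns_strict_def)

lemma tableau_iff:
  assumes "sorted_wrt (\<ge>) (map length T)" "0 \<notin> set (map length T)"
  shows "tableau T \<longleftrightarrow> (\<forall>r \<in> set T. sorted r) \<and> columns_strict T"
  using assms
proof (induction T)
  case (Cons r T)
  then have "length (top_row T) \<le> length r" by (cases T) auto
  with Cons show ?case by (auto simp: columns_strict_Cons row_above_iff)
qed (simp add: columns_strict_def)

lemma tableau_shape: "tableau T \<Longrightarrow> sorted_wrt (\<ge>) (map length T) \<and> 0 \<notin> set (map length T)"
proof (induction T)
  case (Cons r T)
  then show ?case by (cases T) (auto simp: row_above_iff)
qed simp

lemma SSYT_iff:
  assumes "p \<in> partitions n"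
  shows "T \<in> SSYT p \<longleftrightarrow> tableau T \<and> map length T = p"
  using assms tableau_iff[of T] by (auto simp: SSYT_def partitions_def)

lemma tableau_in_partitions:
  assumes "tableau T" "size (mset (concat T)) = n"
  shows "map length T \<in> partitions n"
  using assms tableau_shape[of T] by (simp add: partitions_def length_concat del: mset_concat)

text \<open>The content makes the entries distinct, so weakly increasing rows are strictly
  increasing.\<close>

lemma SYT_iff:
  assumes "p \<in> partitions n"
  shows "T \<in> SYT p \<longleftrightarrow> tableau T \<and> map length T = p \<and> mset (concat T) = mset_set {1..n}"
proof -
  have "sum_list p = n" using assms by (simp add: partitions_def)
  moreover have "distinct (concat T)" if "mset (concat T) = mset_set {1..n}"
    unfolding distinct_count_atmost_1 that mset_eq_interval_set[OF that]
    by (simp add: count_mset_set')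
  then have "(\<forall>r \<in> set T. sorted_wrt (<) r) \<longleftrightarrow> (\<forall>r \<in> set T. sorted r)"
    if "mset (concat T) = mset_set {1..n}"
    using that by (auto simp: strict_sorted_iff distinct_concat_iff)
  ultimately show ?thesis
    using SSYT_iff[OF assms, of T] by (auto simp: SYT_def SSYT_def)
qed

lemma finite_partitions: "finite (partitions n)"
proof (rule finite_subset)
  show "partitions n \<subseteq> {p. set p \<subseteq> {..n} \<and> length p \<le> n}"
  proof
    fix p assume "p \<in> partitions n"
    then have p: "0 \<notin> set p" "sum_list p = n" by (auto simp: partitions_def)
    have "length p \<le> sum_list p" using p(1) by (induction p) auto
    then show "p \<in> {p. set p \<subseteq> {..n} \<and> length p \<le> n}"
      using p member_le_sum_list by auto
  qed
qed (simp add: finite_lists_length_le)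

lemma finite_fillings: "finite {T. map length T = p \<and> mset (concat T) = M}"
proof (rule finite_subset)
  show "{T. map length T = p \<and> mset (concat T) = M} \<subseteq>
      {T. set T \<subseteq> {r. set r \<subseteq> set_mset M \<and> length r \<le> size M} \<and> length T = length p}"
  proof
    fix T assume "T \<in> {T. map length T = p \<and> mset (concat T) = M}"
    then have T: "map length T = p" "M = mset (concat T)" by auto
    have "set r \<subseteq> set_mset M" "length r \<le> size M" if "r \<in> set T" for r
      using that member_le_sum_list[of "length r" "map length T"]
      unfolding T(2) by (auto simp: length_concat simp del: mset_concat)
    then show "T \<in> {T. set T \<subseteq> {r. set r \<subseteq> set_mset M \<and> length r \<le> size M} \<and> length T = length p}"
      using T(1) by auto
  qed
qed (simp add: finite_lists_length_eq finite_lists_length_le)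

lemma finite_words: "finite {w. mset w = M}"
  by (rule finite_subset[of _ "{w. set w \<subseteq> set_mset M \<and> length w = size M}"])
    (auto simp: finite_lists_length_eq)

text \<open>\<open>v\<close> is the position, counted from 1, of the larger letter, so that rises
  can be compared with vertices of the graph.\<close>

definition rises :: "nat list \<Rightarrow> nat set"
  where "rises w = {v \<in> {2..length w}. w ! (v - 2) < w ! (v - 1)}"

text \<open>A descent \<open>i\<close> compares the letters at indices \<open>n - i - 1\<close> and
  \<open>n - i\<close>, hence is a rise at \<open>v = n + 1 - i\<close>, the index at which
  \<open>wt\<close> evaluates \<open>a\<close>.\<close>

lemma wt_rsk:
  assumes "rsk w = (P, Q)" "length w = n"
  shows "wt n a Q = sum a (rises w)"
  unfolding wt_def
proof (rule sum.reindex_bij_witness[of _ "\<lambda>v. n + 1 - v" "\<lambda>i. n + 1 - i"])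
  have *: "i \<in> Des n Q \<longleftrightarrow> n + 1 - i \<in> rises w" if "1 \<le> i" "i \<le> n - 1" for i
    using appears_before_rsk[OF assms(1), of i] that assms(2)
    by (simp add: Des_def rises_def) (auto simp: numeral_2_eq_2)
  show "n + 1 - i \<in> rises w" if "i \<in> Des n Q" for i
    using that * by (auto simp: Des_def)
  show "n + 1 - v \<in> Des n Q" if "v \<in> rises w" for v
    using that assms(2) *[of "n + 1 - v"] by (auto simp: rises_def)
qed (use assms in \<open>auto simp: Des_def rises_def\<close>)

text \<open>For \<open>size M\<close> other than \<open>n\<close> the sum is empty and the
  coefficient is 0.\<close>

lemma mfps_coeff_G_tilde:
  "mfps_coeff (G_tilde n a q) M = (\<Sum>w | mset w = M \<and> length w = n. q ^ sum a (rises w))"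
proof -
  let ?C = "\<lambda>p. {P \<in> SSYT p. mset (concat P) = M}"
  let ?R = "{(P, Q). tableau P \<and> tableau Q \<and> map length P = map length Q \<and>
      mset (concat P) = M \<and> mset (concat Q) = mset_set {1..n}}"
  have fin: "finite (SYT p)" "finite (?C p)" for p
    by (rule finite_subset[OF _ finite_fillings[of p "mset_set {1..sum_list p}"]],
        force simp: SYT_def)
      (rule finite_subset[OF _ finite_fillings[of p M]], force simp: SSYT_def)
  have "mfps_coeff (G_tilde n a q) M = (\<Sum>p \<in> partitions n. \<Sum>T \<in> SYT p. \<Sum>P \<in> ?C p. q ^ wt n a T)"
    by (simp add: G_tilde_def mfps_coeff_sum mfps_coeff_const_mult schur_def mult.commute)
  also have "\<dots> = (\<Sum>(p, T, P) \<in> (SIGMA p:partitions n. SYT p \<times> ?C p). q ^ wt n a T)"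
    unfolding sum.cartesian_product by (subst sum.Sigma) (auto simp: finite_partitions fin)
  \<comment> \<open>The shape \<open>p\<close> is determined by \<open>T\<close>, so the sum over
    shapes is absorbed into the pairs.\<close>
  also have "\<dots> = (\<Sum>(P, T) \<in> ?R. q ^ wt n a T)"
  proof (rule sum.reindex_bij_witness[of _ "\<lambda>(P, T). (map length T, T, P)" "\<lambda>(p, T, P). (P, T)"],
      goal_cases)
    case (4 z)
    then obtain P T where z: "z = (P, T)" "tableau P" "tableau T" "map length P = map length T"
      "mset (concat P) = M" "mset (concat T) = mset_set {1..n}" by blast
    have "map length T \<in> partitions n" using tableau_in_partitions[of T n] z by simp
    then show ?case using z by (simp add: SYT_iff SSYT_iff)
  qed (auto simp: SYT_iff SSYT_iff)
  also have "\<dots> = (\<Sum>w | mset w = M \<and> length w = n. case rsk w of (P, T) \<Rightarrow> q ^ wt n a T)"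
    by (rule sum.reindex_bij_betw[OF bij_betw_rsk, symmetric])
  also have "\<dots> = (\<Sum>w | mset w = M \<and> length w = n. q ^ sum a (rises w))"
    by (intro sum.cong) (auto simp: wt_rsk split: prod.splits)
  finally show ?thesis .
qed

section \<open>Products of elementary symmetric functions as counts of words with increasing
  blocks\<close>

text \<open>The first list entry is the length of the last block, since \<open>sigma_comp\<close>
  lists the gaps from the largest bottom downwards.\<close>

fun block_words :: "nat list \<Rightarrow> nat list set" where
  "block_words [] = {[]}"
| "block_words (k # s) = {u @ v | u v. u \<in> block_words s \<and> sorted_wrt (<) v \<and> length v = k}"

text \<open>A squarefree monomial of degree \<open>k\<close> is the content of exactly one strictly
  increasing word of length \<open>k\<close>; \<open>A\<close> below is the content of the last
  block.\<close>

lemma mfps_coeff_elem_sym_comp: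
  "mfps_coeff (elem_sym_comp s :: 'a::comm_ring_1 mfps) M = of_nat (card {w \<in> block_words s. mset w = M})"
proof (induction s arbitrary: M)
  case Nil
  have "{w. w = [] \<and> mset w = M} = (if M = {#} then {[]} else {})" by auto
  then show ?case by (auto simp: elem_sym_comp_def mfps_coeff_1)
next
  case (Cons k s)
  let ?B = "{A. A \<subseteq># M \<and> size A = k \<and> (\<forall>i. count A i \<le> 1)}"
  let ?U = "\<lambda>A. {u \<in> block_words s. mset u = M - A}"
  have finB: "finite ?B" by (rule finite_subset[OF _ finite_submultisets[of M]]) auto
  have finU: "finite (?U A)" for A by (rule finite_subset[OF _ finite_words[of "M - A"]]) auto
  have "bij_betw (\<lambda>(A, u). u @ sorted_list_of_multiset A) (SIGMA A:?B. ?U A)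
      {w \<in> block_words (k # s). mset w = M}"
  proof (rule bij_betw_byWitness[of _ "\<lambda>w. (mset (drop (length w - k) w), take (length w - k) w)"],
      goal_cases)
    case 1
    have "length (sorted_list_of_multiset A) = size A" for A :: "nat multiset"
      by (metis mset_sorted_list_of_multiset size_mset)
    then show ?case by auto
  next
    case 2
    then show ?case
      by (auto simp: strict_sorted_iff sorted_list_of_multiset_mset sorted_sort_id)
  next
    case 3
    have "length (sorted_list_of_multiset A) = size A"
      "sorted_wrt (<) (sorted_list_of_multiset A) \<longleftrightarrow> (\<forall>i. count A i \<le> 1)" for A :: "nat multiset"
    proof -
      have *: "mset (sorted_list_of_multiset A) = A" by simp
      show "length (sorted_list_of_multiset A) = size A" 
        using size_mset[of "sorted_list_of_multiset A"] unfolding * by simp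
      have "(count A i = (if i \<in># A then 1 else 0)) \<longleftrightarrow> count A i \<le> 1" for i
        by (cases "count A i") (auto simp: not_in_iff)
      then show "sorted_wrt (<) (sorted_list_of_multiset A) \<longleftrightarrow> (\<forall>i. count A i \<le> 1)"
        by (simp add: strict_sorted_iff distinct_count_atmost_1)
    qed
    then show ?case by (auto intro!: exI)
  next
    case 4
    have "count (mset v) i \<le> 1" if "sorted_wrt (<) v" for v :: "nat list" and i
      using that by (auto simp: strict_sorted_iff distinct_count_atmost_1)
    then show ?case by auto
  qed
  then have "card {w \<in> block_words (k # s). mset w = M} = (\<Sum>A\<in>?B. card (?U A))"
    using finB finU by (simp add: bij_betw_same_card[symmetric])
  moreover have "mfps_coeff (elem_sym_comp (k # s) :: 'a mfps) M =
      (\<Sum>A | A \<subseteq># M. (if size A = k \<and> (\<forall>i. count A i \<le> 1) then of_nat (card (?U A)) else 0))"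
  proof -
    have "elem_sym_comp (k # s) = (elem_sym k * elem_sym_comp s :: 'a mfps)"
      by (simp add: elem_sym_comp_def)
    show ?thesis
      unfolding \<open>elem_sym_comp (k # s) = _\<close> mfps_coeff_mult Cons.IH by (auto simp: elem_sym_def intro!: sum.cong)
  qed
  moreover have "\<dots> = (\<Sum>A\<in>?B. of_nat (card (?U A)))"
    using sum.inter_filter[of "{A. A \<subseteq># M}" "\<lambda>A. of_nat (card (?U A)) :: 'a"
        "\<lambda>A. size A = k \<and> (\<forall>i. count A i \<le> 1)"] by simp
  ultimately show ?case by simp
qed

text \<open>\<open>sigma_comp\<close> for an arbitrary set in place of the bottoms, to allow
  induction on the largest element.\<close>

definition gap_list :: "nat \<Rightarrow> nat set \<Rightarrow> nat list"
  where "gap_list n S = (let s = rev (sorted_list_of_set S) in map2 (-) ((n + 1) # s) s)"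

lemma gap_list_rec:
  assumes "finite S" "S \<noteq> {}" "0 \<notin> S"
  shows "gap_list n S = (n + 1 - Max S) # gap_list (Max S - 1) (S - {Max S})"
proof -
  let ?S = "S - {Max S}"
  have "\<forall>x \<in> ?S. x < Max S" using assms by (metis DiffE Max_ge insertCI le_neq_implies_less)
  then have "sorted_wrt (<) (sorted_list_of_set ?S @ [Max S])"
    using assms by (auto simp: sorted_wrt_append)
  moreover have "set (sorted_list_of_set ?S @ [Max S]) = S"
    using assms(1) Max_in[OF assms(1,2)] by auto
  ultimately have "sorted_list_of_set S = sorted_list_of_set ?S @ [Max S]"
    using assms by (metis sorted_list_of_set.idem_if_sorted_distinct strict_sorted_iff)
  \<comment> \<open>Positivity gives \<open>Max S - 1 + 1 = Max S\<close>, the head of the list from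
    which the remaining gaps are taken.\<close>
  moreover have "0 < Max S" using assms(3) Max_in[OF assms(1,2)] by (metis gr0I)
  ultimately show ?thesis by (simp add: gap_list_def Let_def)
qed

text \<open>The elements of \<open>S\<close> are the first positions of the blocks. Every other
  position must be a rise, and nothing is required where two blocks meet. The induction splits off
  the last block.\<close>

lemma block_words_gap_list:
  assumes "S \<subseteq> {1..n}" "0 < n \<Longrightarrow> 1 \<in> S"
  shows "block_words (gap_list n S) = {w. length w = n \<and> {2..n} - S \<subseteq> rises w}"
  using assms
proof (induction n arbitrary: S rule: less_induct)
  case (less n)
  show ?case
  proof (cases "n = 0")
    case True
    then show ?thesis using less by (auto simp: gap_list_def)
  next
    case False
    define m where "m = Max S"
    have S: "finite S" "1 \<in> S" using less.prems False finite_subset[OF less.prems(1)] by auto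
    then have m: "m \<in> S" "1 \<le> m" "m \<le> n" "\<forall>v \<in> S. v \<le> m"
      using less.prems(1) by (auto simp: m_def intro: Max_in)
    have "S \<noteq> {}" "0 \<notin> S" using S less.prems(1) by auto
    then have rec: "gap_list n S = (n + 1 - m) # gap_list (m - 1) (S - {m})"
      unfolding m_def using gap_list_rec S(1) by blast
    have IH: "block_words (gap_list (m - 1) (S - {m})) =
        {u. length u = m - 1 \<and> {2..m - 1} - (S - {m}) \<subseteq> rises u}"
      by (rule less.IH) (use m S less.prems(1) in force)+
    \<comment> \<open>Positions below \<open>m\<close> concern \<open>u\<close> alone and those
      above \<open>m\<close> concern \<open>v\<close> alone; the junction at \<open>m\<close> is in
      \<open>S\<close> and hence free.\<close>
    have key: "{2..n} - S \<subseteq> rises (u @ v) \<longleftrightarrow>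
        {2..m - 1} - (S - {m}) \<subseteq> rises u \<and> sorted_wrt (<) v"
      if uv: "length u = m - 1" "length v = n + 1 - m" for u v
    proof -
      have "{2..n} - S = ({2..m - 1} - (S - {m})) \<union> {m + 1..n}"
      proof (rule set_eqI)
        fix x
        have "x = m \<or> x < m \<or> m < x" "m < x \<Longrightarrow> x \<notin> S" using m(4) by force+
        then show "x \<in> {2..n} - S \<longleftrightarrow> x \<in> ({2..m - 1} - (S - {m})) \<union> {m + 1..n}"
          using m(1-3) by auto
      qed
      moreover have "i \<in> rises (u @ v) \<longleftrightarrow> i \<in> rises u" if "i \<in> {2..m - 1}" for i
        using that uv m by (auto simp: rises_def nth_append)
      moreover have "{m + 1..n} \<subseteq> rises (u @ v) \<longleftrightarrow> sorted_wrt (<) v"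
      proof -
        have "i \<in> rises (u @ v) \<longleftrightarrow> v ! (i - m - 1) < v ! (i - m)" if "i \<in> {m + 1..n}" for i
        proof -
          have "i - 2 - (m - 1) = i - m - 1" "i - 1 - (m - 1) = i - m" "2 \<le> i" "i \<le> n"
            "\<not> i - 2 < m - 1" "\<not> i - 1 < m - 1" "m - 1 + (n + 1 - m) = n"
            using that m by auto
          then show ?thesis using uv by (simp add: rises_def nth_append)
        qed
        then have "{m + 1..n} \<subseteq> rises (u @ v) \<longleftrightarrow> (\<forall>i \<in> {m + 1..n}. v ! (i - m - 1) < v ! (i - m))"
          by blast
        also have "\<dots> \<longleftrightarrow> (\<forall>i. Suc i < length v \<longrightarrow> v ! i < v ! Suc i)"
        proof (intro iffI ballI allI impI)
          fix i assume *: "\<forall>i \<in> {m + 1..n}. v ! (i - m - 1) < v ! (i - m)" "Suc i < length v"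
          then show "v ! i < v ! Suc i" using uv m bspec[OF *(1), of "i + m + 1"] by simp
        next
          fix i assume *: "\<forall>i. Suc i < length v \<longrightarrow> v ! i < v ! Suc i" "i \<in> {m + 1..n}"
          then have "Suc (i - m - 1) = i - m" "i - m < length v" using uv by auto
          then show "v ! (i - m - 1) < v ! (i - m)" using *(1) by metis
        qed
        also have "\<dots> \<longleftrightarrow> sorted_wrt (<) v"
          by (simp add: sorted_wrt_iff_nth_Suc_transp)
        finally show ?thesis .
      qed
      ultimately show ?thesis by blast
    qed
    show ?thesis unfolding rec block_words.simps IH
    proof (intro subset_antisym subsetI)
      fix w assume "w \<in> {w. length w = n \<and> {2..n} - S \<subseteq> rises w}"
      then have w: "length w = n" "{2..n} - S \<subseteq> rises w" by auto
      have "w = take (m - 1) w @ drop (m - 1) w" "length (take (m - 1) w) = m - 1"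
        "length (drop (m - 1) w) = n + 1 - m" using w(1) m by auto
      then show "w \<in> {u @ v |u v. u \<in> {u. length u = m - 1 \<and> {2..m - 1} - (S - {m}) \<subseteq> rises u} \<and>
          sorted_wrt (<) v \<and> length v = n + 1 - m}"
        using key[of "take (m - 1) w" "drop (m - 1) w"] w(2) by (smt (verit) mem_Collect_eq)
    qed (use key m in auto)
  qed
qed

section \<open>Orientations as sets of ascending edges\<close>

text \<open>An orientation consists of its ascending edges \<open>A\<close> and the reversals of
  \<open>E - A\<close>; as edges of \<open>E\<close> go upwards, \<open>E\<close> and its converse
  are disjoint.\<close>

lemma sum_orientations:
  assumes "finite E" "\<And>u v. (u, v) \<in> E \<Longrightarrow> u < v"
  shows "(\<Sum>\<theta> \<in> orientations E. f (\<theta> \<inter> E)) = sum f (Pow E)"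
proof (rule sum.reindex_bij_witness[of _ "\<lambda>A. A \<union> (E - A)\<inverse>" "\<lambda>\<theta>. \<theta> \<inter> E"])
  have E: "(u, v) \<in> E \<Longrightarrow> (v, u) \<notin> E" for u v using assms(2) by (metis less_asym)
  show "\<theta> \<inter> E \<union> (E - \<theta> \<inter> E)\<inverse> = \<theta>" if "\<theta> \<in> orientations E" for \<theta>
    using that E unfolding orientations_def by (auto simp: set_eq_iff)
  show "(A \<union> (E - A)\<inverse>) \<inter> E = A" if "A \<in> Pow E" for A using that E by auto
  show "A \<union> (E - A)\<inverse> \<in> orientations E" if "A \<in> Pow E" for A
    using that E unfolding orientations_def by auto
qed auto

lemma ascending_edges:
  assumes "\<theta> \<in> orientations E" "\<And>u v. (u, v) \<in> E \<Longrightarrow> u < v"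
  shows "{(u, v) \<in> \<theta>. u < v} = \<theta> \<inter> E"
proof -
  have "\<theta> \<subseteq> E \<union> E\<inverse>" using assms(1) by (auto simp: orientations_def)
  then show ?thesis using assms(2) by (fastforce dest: less_asym)
qed

text \<open>Expansion of a product of factors \<open>q + 1\<close>: \<open>A\<close> collects the
  factors that contribute \<open>q\<close>.\<close>

lemma sum_power_card_Pow:
  fixes q :: "'a::comm_semiring_1"
  assumes "finite F"
  shows "(\<Sum>A \<in> Pow F. q ^ card A) = (q + 1) ^ card F"
  using prod_add[OF assms, of "\<lambda>_. q" "\<lambda>_. 1"] by simp

lemma sum_swap_Pow:
  fixes q :: "'a::comm_ring_1"
  assumes "finite E" "finite W"
  shows "(\<Sum>A \<in> Pow E. q ^ card A * of_nat (card {w \<in> W. snd ` A \<subseteq> R w})) =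
    (\<Sum>w \<in> W. (q + 1) ^ card {e \<in> E. snd e \<in> R w})"
proof -
  have "(\<Sum>A \<in> Pow E. q ^ card A * of_nat (card {w \<in> W. snd ` A \<subseteq> R w})) =
      (\<Sum>A \<in> Pow E. \<Sum>w \<in> W. if snd ` A \<subseteq> R w then q ^ card A else 0)"
    using assms by (intro sum.cong) (auto simp: sum.inter_filter[symmetric] mult.commute)
  also have "\<dots> = (\<Sum>w \<in> W. \<Sum>A \<in> Pow E. if snd ` A \<subseteq> R w then q ^ card A else 0)"
    by (rule sum.swap)
  also have "\<dots> = (\<Sum>w \<in> W. \<Sum>A \<in> Pow {e \<in> E. snd e \<in> R w}. q ^ card A)"
  proof (rule sum.cong)
    fix w
    have "Pow {e \<in> E. snd e \<in> R w} = {A \<in> Pow E. snd ` A \<subseteq> R w}" by auto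
    then show "(\<Sum>A \<in> Pow E. if snd ` A \<subseteq> R w then q ^ card A else 0) =
        (\<Sum>A \<in> Pow {e \<in> E. snd e \<in> R w}. q ^ card A)"
      using sum.inter_filter[of "Pow E" "\<lambda>A. q ^ card A" "\<lambda>A. snd ` A \<subseteq> R w"] assms by simp
  qed simp
  also have "\<dots> = (\<Sum>w \<in> W. (q + 1) ^ card {e \<in> E. snd e \<in> R w})"
    using assms by (simp add: sum_power_card_Pow)
  finally show ?thesis .
qed

lemma card_Gamma_edges:
  assumes "area_sequence n a" "R \<subseteq> {1..n}"
  shows "card {e \<in> Gamma_edges n a. snd e \<in> R} = sum a R"
proof -
  have "{e \<in> Gamma_edges n a. snd e \<in> R} = prod.swap ` (SIGMA i:R. {i - a i..i - 1})"
    using assms(2) by (force simp: Gamma_edges_def image_iff)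
  then have "card {e \<in> Gamma_edges n a. snd e \<in> R} = card (SIGMA i:R. {i - a i..i - 1})"
    by (simp add: card_image)
  also have "\<dots> = (\<Sum>i \<in> R. card {i - a i..i - 1})"
    using finite_subset[OF assms(2)] by simp
  also have "\<dots> = sum a R"
  proof (rule sum.cong)
    fix i assume "i \<in> R"
    \<comment> \<open>These bounds rule out truncation in both \<open>i - a i\<close> and
      \<open>i - 1\<close>; for \<open>a i = 0\<close> the interval is then empty.\<close>
    then have "1 \<le> i" "a i \<le> i - 1" using assms by (auto simp: area_sequence_def)
    then show "card {i - a i..i - 1} = a i" by simp
  qed simp
  finally show ?thesis .
qed

theorem theorem6p6:
  fixes n :: nat and a :: "nat \<Rightarrow> nat" and q :: "'r::comm_ring_1"
  assumes "area_sequence n a"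
  shows "G_tilde n a (q + 1) =
    (\<Sum>\<theta> \<in> orientations (Gamma_edges n a).
      mfps_const (q ^ asc \<theta>) * elem_sym_comp (sigma_comp n \<theta>))"
proof (rule mfps_ext)
  fix M :: "nat multiset"
  let ?E = "Gamma_edges n a"
  let ?W = "{w. mset w = M \<and> length w = n}"
  \<comment> \<open>The bound on \<open>a\<close> keeps lower ends at least 1, so vertex 1 is never
    an upper end.\<close>
  have E: "u < v" "1 \<le> u" "v \<le> n" if "(u, v) \<in> ?E" for u v
  proof -
    have "1 \<le> v" "v \<le> n" "v - a v \<le> u" "u \<le> v - 1" using that by (auto simp: Gamma_edges_def)
    moreover then have "a v \<le> v - 1" using assms by (auto simp: area_sequence_def)
    ultimately show "u < v" "1 \<le> u" "v \<le> n" by auto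
  qed
  have finE: "finite ?E"
    by (rule finite_subset[of _ "{1..n} \<times> {1..n}"]) (use E in force)+
  have finW: "finite ?W" by (rule finite_subset[OF _ finite_words[of M]]) auto
  \<comment> \<open>Each summand depends on \<open>\<theta>\<close> only through
    \<open>\<theta> \<inter> ?E\<close>, the form that \<open>sum_orientations\<close>
    requires.\<close>
  have summand: "mfps_coeff (mfps_const (q ^ asc \<theta>) * elem_sym_comp (sigma_comp n \<theta>)) M =
      q ^ card (\<theta> \<inter> ?E) * of_nat (card {w \<in> ?W. snd ` (\<theta> \<inter> ?E) \<subseteq> rises w})"
    if \<theta>: "\<theta> \<in> orientations ?E" for \<theta>
  proof -
    have asc: "{(u, v) \<in> \<theta>. u < v} = \<theta> \<inter> ?E" by (rule ascending_edges[OF \<theta> E(1)])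
    have up: "(u, v) \<in> \<theta> \<and> u < v \<longleftrightarrow> (u, v) \<in> \<theta> \<inter> ?E" for u v using asc by blast
    \<comment> \<open>The vertices that are not bottoms are the upper ends of ascending edges; they
      are the positions where a rise is forced.\<close>
    have b: "{2..n} - bottoms n \<theta> = snd ` (\<theta> \<inter> ?E)" "0 < n \<Longrightarrow> 1 \<in> bottoms n \<theta>"
      "bottoms n \<theta> \<subseteq> {1..n}"
    proof -
      show "{2..n} - bottoms n \<theta> = snd ` (\<theta> \<inter> ?E)"
      proof (intro subset_antisym subsetI)
        fix v assume "v \<in> {2..n} - bottoms n \<theta>"
        then obtain u where "u < v" "(u, v) \<in> \<theta>" by (auto simp: bottoms_def)
        then have "(u, v) \<in> \<theta> \<inter> ?E" using up by blast
        then show "v \<in> snd ` (\<theta> \<inter> ?E)" by (rule image_eqI[rotated]) simp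
      next
        fix v assume "v \<in> snd ` (\<theta> \<inter> ?E)"
        then obtain u where u: "(u, v) \<in> \<theta> \<inter> ?E" by auto
        then have "(u, v) \<in> \<theta>" "u < v" "1 \<le> u" "v \<le> n" using E[of u v] by auto
        then show "v \<in> {2..n} - bottoms n \<theta>" by (auto simp: bottoms_def)
      qed
      show "1 \<in> bottoms n \<theta>" if "0 < n"
      proof -
        have False if "u < 1" "(u, 1) \<in> \<theta>" for u
        proof -
          have "(u, 1) \<in> ?E" using up[of u 1] that by blast
          then show False using E(2)[of u 1] that(1) by simp
        qed
        then show ?thesis using \<open>0 < n\<close> unfolding bottoms_def by auto
      qed
    qed (auto simp: bottoms_def)
    have "block_words (sigma_comp n \<theta>) = {w. length w = n \<and> snd ` (\<theta> \<inter> ?E) \<subseteq> rises w}"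
      using block_words_gap_list[OF b(3,2)] unfolding b(1) gap_list_def sigma_comp_def by simp
    then have "{w \<in> block_words (sigma_comp n \<theta>). mset w = M} =
        {w \<in> ?W. snd ` (\<theta> \<inter> ?E) \<subseteq> rises w}" by auto
    then show ?thesis
      by (simp add: mfps_coeff_const_mult mfps_coeff_elem_sym_comp asc_def asc)
  qed
  have "mfps_coeff (\<Sum>\<theta> \<in> orientations ?E. mfps_const (q ^ asc \<theta>) * elem_sym_comp (sigma_comp n \<theta>)) M =
      (\<Sum>\<theta> \<in> orientations ?E.
        q ^ card (\<theta> \<inter> ?E) * of_nat (card {w \<in> ?W. snd ` (\<theta> \<inter> ?E) \<subseteq> rises w}))"
    by (simp add: mfps_coeff_sum summand)
  also have "\<dots> = (\<Sum>A \<in> Pow ?E. q ^ card A * of_nat (card {w \<in> ?W. snd ` A \<subseteq> rises w}))"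
    by (rule sum_orientations[OF finE E(1)])
  also have "\<dots> = (\<Sum>w \<in> ?W. (q + 1) ^ card {e \<in> ?E. snd e \<in> rises w})"
    by (rule sum_swap_Pow[OF finE finW])
  also have "\<dots> = (\<Sum>w \<in> ?W. (q + 1) ^ sum a (rises w))"
  proof (rule sum.cong)
    fix w assume "w \<in> ?W"
    then have "rises w \<subseteq> {1..n}" by (auto simp: rises_def)
    then show "(q + 1) ^ card {e \<in> ?E. snd e \<in> rises w} = (q + 1) ^ sum a (rises w)"
      by (simp add: card_Gamma_edges[OF assms])
  qed simp
  finally show "mfps_coeff (G_tilde n a (q + 1)) M =
      mfps_coeff (\<Sum>\<theta> \<in> orientations ?E. mfps_const (q ^ asc \<theta>) * elem_sym_comp (sigma_comp n \<theta>)) M"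
    by (simp add: mfps_coeff_G_tilde)
qed

end
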